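(* Let $M$ be a manifold. Then the following conditions are all equivalent (each individual condition listed within an item being equivalent to all the others): (1) $M$ is separable; (2) $M$ satisfies any one (hence all) of the selection principles $\mathsf S_1(\mathcal K,\mathcal D)$, $\mathsf S_1(\Omega,\mathcal D)$, $\mathsf S_1(\Lambda,\mathcal D)$, $\mathsf S_1(\mathcal O,\mathcal D)$, $\mathsf S_1(\mathcal D,\mathcal D)$; (3) $M$ satisfies any one (hence all) of the selection principles $\mathsf S_{fin}(\mathcal K,\mathcal D)$, $\mathsf S_{fin}(\Omega,\mathcal D)$, $\mathsf S_{fin}(\Lambda,\mathcal D)$, $\mathsf S_{fin}(\mathcal O,\mathcal D)$, $\mathsf S_{fin}(\mathcal D,\mathcal D)$; (4) every $k$-cover (respectively every $\omega$-cover, every large cover, every open cover) of $M$ contains a countable subfamily whose union is dense in $M$; (5) every family of open subsets of $M$ whose union is dense in $M$ contains a countable subfamily whose union is dense in $M$.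
   Context: A manifold is a non-empty, connected, Hausdorff space each point of which has a neighbourhood homeomorphic to $\mathbb R^n$ for some natural number $n$. An open cover of a space $X$ is a set of open subsets of $X$ whose union is $X$; covers are not assumed to be countable. For a space $X$: - $\mathcal O$ is the family of all open covers of $X$. - $\Lambda$ is the family of large covers of $X$: open covers $\mathcal U$ such that $X\notin\mathcal U$ and every point of $X$ is contained in infinitely many members of $\mathcal U$. - $\Omega$ is the family of $\omega$-covers of $X$: open covers $\mathcal U$ such that $X\notin\mathcal U$ and every finite subset of $X$ is contained in some member of $\mathcal U$. - $\mathcal K$ is the family of $k$-covers of $X$: open covers $\mathcal U$ such that $X\notin\mathcal U$ and every compact subset of $X$ is contained in some member of $\mathcal U$. - $\mathcal D$ is the family of collections of open subsets of $X$ whose union is dense in $X$. A space satisfies $\mathsf S_1(\mathcal A,\mathcal B)$ if for each sequence $\langle A_n\rangle_{n\in\omega}$ of members of $\mathcal A$ there is a sequence $\langle b_n\rangle_{n\in\omega}$ such that $b_n\in A_n$ for each $n$ and $\{b_n : n\in\omega\}\in\mathcal B$. It satisfies $\mathsf S_{fin}(\mathcal A,\mathcal B)$ if for each sequence $\langle A_n\rangle_{n\in\omega}$ of members of $\mathcal A$ there is a sequence $\langle B_n\rangle_{n\in\omega}$ of finite sets such that $B_n\subset A_n$ for each $n$ and $\bigcup_{n\in\omega}B_n\in\mathcal B$. *)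

theory Defs
  imports "HOL-Analysis.Analysis"
begin

(* The dimension may a priori depend on the point, and the neighbourhood N need not be open.
   Neither second countability nor metrizability is assumed. *)
definition manifold :: "'a topology \<Rightarrow> bool" where
  "manifold X \<longleftrightarrow>
     topspace X \<noteq> {} \<and> connected_space X \<and> Hausdorff_space X \<and>
     (\<forall>x\<in>topspace X. \<exists>N \<subseteq> topspace X.
        (\<exists>W. openin X W \<and> x \<in> W \<and> W \<subseteq> N) \<and>
        (\<exists>n. subtopology X N homeomorphic_space Euclidean_space n))"

definition open_covers :: "'a topology \<Rightarrow> 'a set set set" where
  "open_covers X = {\<U>. (\<forall>U\<in>\<U>. openin X U) \<and> \<Union>\<U> = topspace X}"

definition large_covers :: "'a topology \<Rightarrow> 'a set set set" where
  "large_covers X = {\<U> \<in> open_covers X. topspace X \<notin> \<U> \<and>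
     (\<forall>x\<in>topspace X. infinite {U \<in> \<U>. x \<in> U})}"

definition omega_covers :: "'a topology \<Rightarrow> 'a set set set" where
  "omega_covers X = {\<U> \<in> open_covers X. topspace X \<notin> \<U> \<and>
     (\<forall>F. finite F \<and> F \<subseteq> topspace X \<longrightarrow> (\<exists>U\<in>\<U>. F \<subseteq> U))}"

(* compactin X K includes K \<subseteq> topspace X. *)
definition k_covers :: "'a topology \<Rightarrow> 'a set set set" where
  "k_covers X = {\<U> \<in> open_covers X. topspace X \<notin> \<U> \<and>
     (\<forall>K. compactin X K \<longrightarrow> (\<exists>U\<in>\<U>. K \<subseteq> U))}"

definition dense_families :: "'a topology \<Rightarrow> 'a set set set" where
  "dense_families X = {\<U>. (\<forall>U\<in>\<U>. openin X U) \<and> X closure_of \<Union>\<U> = topspace X}"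

definition S_one :: "'b set set \<Rightarrow> 'b set set \<Rightarrow> bool" where
  "S_one \<A> \<B> \<longleftrightarrow>
     (\<forall>A :: nat \<Rightarrow> 'b set. (\<forall>n. A n \<in> \<A>) \<longrightarrow>
        (\<exists>b. (\<forall>n. b n \<in> A n) \<and> range b \<in> \<B>))"

definition S_fin :: "'b set set \<Rightarrow> 'b set set \<Rightarrow> bool" where
  "S_fin \<A> \<B> \<longleftrightarrow>
     (\<forall>A :: nat \<Rightarrow> 'b set. (\<forall>n. A n \<in> \<A>) \<longrightarrow>
        (\<exists>B. (\<forall>n. finite (B n) \<and> B n \<subseteq> A n) \<and> (\<Union>n. B n) \<in> \<B>))"

(* Every member of \<A> contains a countable (possibly finite) subfamily with dense union. *)
definition countable_dense_subfamilies :: "'a topology \<Rightarrow> 'a set set set \<Rightarrow> bool" where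
  "countable_dense_subfamilies X \<A> \<longleftrightarrow>
     (\<forall>\<U>\<in>\<A>. \<exists>\<V> \<subseteq> \<U>. countable \<V> \<and> X closure_of \<Union>\<V> = topspace X)"

end

(* A separable manifold has a countable pi-base (a countable local base at each point of a countable
   dense set), and choosing the n-th member so as to meet the n-th element of the pi-base yields
   S_one D D, the strongest principle. The weakest one is that every k-cover has a countable subfamily
   with dense union. If M were not separable, then, M being locally separable, the open separable
   subsets of M would form a k-cover, and a countable subfamily with dense union would make M
   separable after all. *)

theory Submission
  imports Defs
begin

section \<open>Separability of countable unions\<close>

text \<open>Countable dense subsets of the members together form a countable set. Its closure
  contains every member, hence the dense union, hence the closure of that union.\<close>

lemma separable_space_dense_Union:
  assumes "countable \<V>" and sub: "\<Union>\<V> \<subseteq> topspace X"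
    and sep: "\<And>V. V \<in> \<V> \<Longrightarrow> separable_space (subtopology X V)"
    and dense: "X closure_of \<Union>\<V> = topspace X"
  shows "separable_space X"
proof -
  have "\<exists>C. countable C \<and> C \<subseteq> V \<and> V \<subseteq> X closure_of C" if V: "V \<in> \<V>" for V
  proof -
    have top: "topspace (subtopology X V) = V"
      using sub V by auto
    obtain C where C: "countable C" "C \<subseteq> V" "subtopology X V closure_of C = V"
      using sep [OF V] unfolding separable_space_def top by blast
    then show ?thesis
      \<comment> \<open>Closure in the subspace \<open>V\<close> lies in the closure in
        \<open>X\<close>, so density in \<open>V\<close> transfers to the closure in
        \<open>X\<close>.\<close>
      by (metis closure_of_subtopology_subset)
  qed
  then obtain C where C: "\<And>V. V \<in> \<V> \<Longrightarrow> countable (C V) \<and> C V \<subseteq> V \<and> V \<subseteq> X closure_of (C V)"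
    by metis
  let ?D = "\<Union>(C ` \<V>)"
  have "\<Union>\<V> \<subseteq> X closure_of ?D"
    using C closure_of_mono [of "C _" ?D X] by blast
  then have "topspace X \<subseteq> X closure_of ?D"
    using dense by (metis closure_of_minimal closedin_closure_of)
  then have "X closure_of ?D = topspace X"
    by (simp add: closure_of_subset_topspace subset_antisym)
  moreover have "countable ?D" "?D \<subseteq> topspace X"
    using C sub assms(1) by (blast+)
  ultimately show ?thesis
    unfolding separable_space_def by blast
qed

text \<open>Inside the subspace on the union, the union is the whole space and so trivially dense;
  the previous lemma applies there.\<close>

lemma separable_space_Union:
  assumes "countable \<V>" and "\<Union>\<V> \<subseteq> topspace X"
    and "\<And>V. V \<in> \<V> \<Longrightarrow> separable_space (subtopology X V)"
  shows "separable_space (subtopology X (\<Union>\<V>))"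
proof (rule separable_space_dense_Union [OF assms(1)])
  have top: "topspace (subtopology X (\<Union>\<V>)) = \<Union>\<V>"
    using assms(2) by auto
  show "\<Union>\<V> \<subseteq> topspace (subtopology X (\<Union>\<V>))"
    by (simp only: top)
  show "subtopology X (\<Union>\<V>) closure_of \<Union>\<V> = topspace (subtopology X (\<Union>\<V>))"
    by (metis closure_of_topspace top)
  show "separable_space (subtopology (subtopology X (\<Union>\<V>)) V)" if "V \<in> \<V>" for V
    using assms(3) [OF that] that
    by (simp add: subtopology_subtopology inf_absorb2 Union_upper)
qed

section \<open>Countable pi-bases and the selection from dense families\<close>

text \<open>A nonempty open set meets the countable dense set in some point \<open>x\<close>, and
  then contains a member of the countable local base at \<open>x\<close>. The pi-base is indexed by
  the naturals so that it can be matched with a sequence of families.\<close>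

lemma separable_first_countable_pi_base:
  assumes "separable_space X" and "first_countable X" and "topspace X \<noteq> {}"
  shows "\<exists>P :: nat \<Rightarrow> 'a set. (\<forall>n. openin X (P n) \<and> P n \<noteq> {}) \<and>
    (\<forall>U. openin X U \<and> U \<noteq> {} \<longrightarrow> (\<exists>n. P n \<subseteq> U))"
proof -
  obtain C where C: "countable C" "C \<subseteq> topspace X" "X closure_of C = topspace X"
    using assms(1) unfolding separable_space_def by blast
  have "\<forall>x \<in> C. \<exists>\<B>. countable \<B> \<and> (\<forall>V \<in> \<B>. openin X V) \<and>
             (\<forall>U. openin X U \<and> x \<in> U \<longrightarrow> (\<exists>V \<in> \<B>. x \<in> V \<and> V \<subseteq> U))"
    using assms(2) C(2) unfolding first_countable_def by blast
  then obtain \<B> where \<B>: "\<And>x. x \<in> C \<Longrightarrow> countable (\<B> x)"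
      "\<And>x V. x \<in> C \<Longrightarrow> V \<in> \<B> x \<Longrightarrow> openin X V"
      "\<And>x U. x \<in> C \<Longrightarrow> openin X U \<Longrightarrow> x \<in> U \<Longrightarrow> \<exists>V \<in> \<B> x. x \<in> V \<and> V \<subseteq> U"
    by metis
  \<comment> \<open>Removing the empty set loses nothing: the local base members chosen below
    contain a point of \<open>C\<close>.\<close>
  define \<P> where "\<P> = \<Union>(\<B> ` C) - {{}}"
  have base: "\<exists>V \<in> \<P>. V \<subseteq> U" if U: "openin X U" "U \<noteq> {}" for U
  proof -
    have "C \<inter> U \<noteq> {}"
      using C(3) U by (simp add: dense_intersects_open)
    then obtain x where x: "x \<in> C" "x \<in> U"
      by blast
    obtain V where "V \<in> \<B> x" "x \<in> V" "V \<subseteq> U"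
      using \<B>(3) [OF x(1) U(1) x(2)] by blast
    then show ?thesis
      using x(1) unfolding \<P>_def by blast
  qed
  \<comment> \<open>\<open>from_nat_into\<close> enumerates exactly \<open>\<P>\<close>, with
    repetitions if it is finite, once \<open>\<P>\<close> is countable and nonempty. The latter
    comes from a pi-base element inside the nonempty whole space.\<close>
  have "\<P> \<noteq> {}"
    using base [OF openin_topspace assms(3)] by blast
  moreover have "countable \<P>"
    using C(1) \<B>(1) unfolding \<P>_def by auto
  ultimately have range: "range (from_nat_into \<P>) = \<P>"
    by simp
  have P: "openin X V \<and> V \<noteq> {}" if "V \<in> \<P>" for V
    using that \<B>(2) unfolding \<P>_def by auto
  show ?thesis
  proof (intro exI [of _ "from_nat_into \<P>"] conjI allI impI)
    show "openin X (from_nat_into \<P> n)" "from_nat_into \<P> n \<noteq> {}" for n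
      using P from_nat_into [OF \<open>\<P> \<noteq> {}\<close>] by auto
    show "\<exists>n. from_nat_into \<P> n \<subseteq> U" if "openin X U \<and> U \<noteq> {}" for U
      using base [of U] that range by (metis rangeE)
  qed
qed

text \<open>One choice per pi-base element suffices: \<open>b n\<close> is chosen to meet
  \<open>P n\<close>, and every nonempty open set contains some \<open>P n\<close>, hence meets the
  union of the choices.\<close>

lemma S_one_dense_families:
  assumes "separable_space X" and "first_countable X" and "topspace X \<noteq> {}"
  shows "S_one (dense_families X) (dense_families X)"
  unfolding S_one_def
proof (intro allI impI)
  fix A :: "nat \<Rightarrow> 'a set set"
  assume A: "\<forall>n. A n \<in> dense_families X"
  obtain P where P: "\<forall>n. openin X (P n) \<and> P n \<noteq> {}"
    "\<forall>U. openin X U \<and> U \<noteq> {} \<longrightarrow> (\<exists>n::nat. P n \<subseteq> U)"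
    using separable_first_countable_pi_base [OF assms] by (elim exE conjE)
  have "\<exists>V \<in> A n. V \<inter> P n \<noteq> {}" for n
  proof -
    have "X closure_of \<Union>(A n) = topspace X"
      using A by (auto simp: dense_families_def)
    then have "\<Union>(A n) \<inter> P n \<noteq> {}"
      using P(1) by (metis dense_intersects_open)
    then show ?thesis
      by blast
  qed
  then obtain b where b: "\<And>n. b n \<in> A n" "\<And>n. b n \<inter> P n \<noteq> {}"
    by metis
  have "X closure_of \<Union>(range b) = topspace X"
    unfolding dense_intersects_open
  proof (intro allI impI)
    fix U assume "openin X U \<and> U \<noteq> {}"
    then obtain n where "P n \<subseteq> U"
      using P(2) by blast
    with b(2) [of n] show "\<Union>(range b) \<inter> U \<noteq> {}"
      by blast
  qed
  moreover have "openin X (b n)" for n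
    using A b(1) [of n] by (auto simp: dense_families_def)
  ultimately have "range b \<in> dense_families X"
    by (auto simp: dense_families_def)
  then show "\<exists>b. (\<forall>n. b n \<in> A n) \<and> range b \<in> dense_families X"
    using b(1) by blast
qed

section \<open>From k-covers back to separability\<close>

lemma separable_space_if_k_covers:
  assumes loc: "\<And>x. x \<in> topspace X \<Longrightarrow> \<exists>W. openin X W \<and> x \<in> W \<and> separable_space (subtopology X W)"
    and "countable_dense_subfamilies X (k_covers X)"
  shows "separable_space X"
proof (rule ccontr)
  assume nonsep: "\<not> separable_space X"
  define \<U> where "\<U> = {W. openin X W \<and> separable_space (subtopology X W)}"
  have opens: "\<And>U. U \<in> \<U> \<Longrightarrow> openin X U"
    by (simp add: \<U>_def)
  have "\<Union>\<U> = topspace X"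
  proof
    show "\<Union>\<U> \<subseteq> topspace X"
      using opens by (simp add: Union_least openin_subset)
    show "topspace X \<subseteq> \<Union>\<U>"
      using loc by (fastforce simp: \<U>_def)
  qed
  with opens have "\<U> \<in> open_covers X"
    by (simp add: open_covers_def)
  \<comment> \<open>The assumed nonseparability supplies the properness that a k-cover
    requires.\<close>
  moreover have "topspace X \<notin> \<U>"
    using nonsep by (simp add: \<U>_def)
  \<comment> \<open>\<open>\<U>\<close> is closed under finite unions, so the union of a finite
    subcover of \<open>K\<close> is itself a single member.\<close>
  moreover have "\<exists>U \<in> \<U>. K \<subseteq> U" if K: "compactin X K" for K
  proof -
    have "K \<subseteq> \<Union>\<U>"
      using compactin_subset_topspace [OF K] \<open>\<Union>\<U> = topspace X\<close> by simp
    with K opens have "\<exists>\<F>. finite \<F> \<and> \<F> \<subseteq> \<U> \<and> K \<subseteq> \<Union>\<F>"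
      by (rule compactinD)
    then obtain \<F> where \<F>: "finite \<F>" "\<F> \<subseteq> \<U>" "K \<subseteq> \<Union>\<F>"
      by (elim exE conjE)
    have op: "openin X (\<Union>\<F>)"
      using \<F>(2) opens by (simp add: openin_Union subset_iff)
    have "separable_space (subtopology X (\<Union>\<F>))"
    proof (rule separable_space_Union)
      show "countable \<F>"
        using \<F>(1) by (rule countable_finite)
      show "\<Union>\<F> \<subseteq> topspace X"
        using op by (rule openin_subset)
      show "separable_space (subtopology X V)" if "V \<in> \<F>" for V
        using \<F>(2) that by (auto simp: \<U>_def)
    qed
    with op have "\<Union>\<F> \<in> \<U>"
      by (simp add: \<U>_def)
    with \<F>(3) show ?thesis
      by blast
  qed
  ultimately have "\<U> \<in> k_covers X"
    by (simp add: k_covers_def)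
  then have "\<exists>\<V> \<subseteq> \<U>. countable \<V> \<and> X closure_of \<Union>\<V> = topspace X"
    by (rule assms(2) [unfolded countable_dense_subfamilies_def, THEN bspec])
  then obtain \<V> where \<V>: "\<V> \<subseteq> \<U>" "countable \<V>" "X closure_of \<Union>\<V> = topspace X"
    by (elim exE conjE)
  have "\<Union>\<V> \<subseteq> topspace X"
    using Union_mono [OF \<V>(1)] \<open>\<Union>\<U> = topspace X\<close> by simp
  with \<V>(2) have "separable_space X"
  proof (rule separable_space_dense_Union)
    show "separable_space (subtopology X V)" if "V \<in> \<V>" for V
      using \<V>(1) that by (auto simp: \<U>_def)
  qed (rule \<V>(3))
  with nonsep show False ..
qed

section \<open>Local countability properties of manifolds\<close>

text \<open>\<open>Euclidean_space n\<close> is a subspace of the countable product of real lines,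
  which has a countable base; second countability is hereditary.\<close>

lemma second_countable_Euclidean_space: "second_countable (Euclidean_space n)"
proof -
  obtain \<B> :: "(nat \<Rightarrow> real) set set" where "countable \<B>" "topological_basis \<B>"
    using ex_countable_basis by blast
  then have "second_countable (euclidean :: (nat \<Rightarrow> real) topology)"
    unfolding second_countable_def
    by (metis open_openin topological_basisE topological_basis_open)
  then show ?thesis
    unfolding Euclidean_space_def euclidean_product_topology by (rule second_countable_subtopology)
qed

text \<open>The Euclidean neighbourhood \<open>N\<close> need not be open, so its countable base is
  restricted to the open set \<open>W\<close> inside it. This yields both local separability and
  first countability.\<close>

lemma manifold_locally_second_countable:
  assumes "manifold M" and "x \<in> topspace M"
  obtains W where "openin M W" "x \<in> W" "second_countable (subtopology M W)"
proof -
  obtain N W n where "openin M W" "x \<in> W" "W \<subseteq> N"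
      and "subtopology M N homeomorphic_space Euclidean_space n"
    using assms unfolding manifold_def by meson
  moreover from this have "second_countable (subtopology M N)"
    by (simp add: homeomorphic_space_second_countability second_countable_Euclidean_space)
  then have "second_countable (subtopology (subtopology M N) W)"
    by (rule second_countable_subtopology)
  then have "second_countable (subtopology M W)"
    using \<open>W \<subseteq> N\<close> by (simp add: subtopology_subtopology inf_absorb2)
  ultimately show ?thesis
    using that by blast
qed

text \<open>A countable base of an open neighbourhood \<open>W\<close> of \<open>x\<close> serves as
  a local base at \<open>x\<close>: sets open in \<open>W\<close> are open in \<open>M\<close>, and
  any open \<open>U\<close> around \<open>x\<close> may be cut down to
  \<open>W \<inter> U\<close>.\<close>

lemma manifold_first_countable:
  assumes "manifold M"
  shows "first_countable M"
  unfolding first_countable_def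
proof
  fix x assume "x \<in> topspace M"
  then obtain W where W: "openin M W" "x \<in> W" "second_countable (subtopology M W)"
    using manifold_locally_second_countable [OF assms] by blast
  then obtain \<B> where \<B>: "countable \<B>" "\<forall>V \<in> \<B>. openin (subtopology M W) V"
      "\<forall>U x. openin (subtopology M W) U \<and> x \<in> U \<longrightarrow> (\<exists>V \<in> \<B>. x \<in> V \<and> V \<subseteq> U)"
    unfolding second_countable_def by auto
  have "\<exists>V \<in> \<B>. x \<in> V \<and> V \<subseteq> U" if "openin M U" "x \<in> U" for U
  proof -
    have "openin (subtopology M W) (W \<inter> U)"
      using that(1) by (rule openin_subtopology_Int2)
    then show ?thesis
      using \<B>(3) that(2) W(2) by (metis IntI le_inf_iff)
  qed
  moreover have "\<forall>V \<in> \<B>. openin M V"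
    using \<B>(2) W(1) by (simp add: openin_open_subtopology)
  ultimately show "\<exists>\<B>. countable \<B> \<and> (\<forall>V \<in> \<B>. openin M V) \<and>
      (\<forall>U. openin M U \<and> x \<in> U \<longrightarrow> (\<exists>V \<in> \<B>. x \<in> V \<and> V \<subseteq> U))"
    using \<B>(1) by blast
qed

section \<open>Inclusions between the families of covers\<close>

text \<open>Finite sets are compact.\<close>

lemma k_covers_subset_omega_covers: "k_covers X \<subseteq> omega_covers X"
  unfolding k_covers_def omega_covers_def by (auto intro: finite_imp_compactin)

text \<open>If only finitely many members contained \<open>x\<close>, then \<open>x\<close> together
  with one point missed by each of them would be a finite set contained in no member.\<close>

lemma omega_covers_subset_large_covers: "omega_covers X \<subseteq> large_covers X"
proof
  fix \<U> assume \<U>: "\<U> \<in> omega_covers X"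
  have "infinite {U \<in> \<U>. x \<in> U}" if x: "x \<in> topspace X" for x
  proof
    let ?F = "{U \<in> \<U>. x \<in> U}"
    assume fin: "finite ?F"
    have "\<exists>y. y \<in> topspace X - U" if "U \<in> \<U>" for U
    proof -
      have "U \<subseteq> topspace X" "U \<noteq> topspace X"
        using \<U> that by (auto simp: omega_covers_def open_covers_def)
      then show ?thesis by blast
    qed
    then obtain y where y: "\<And>U. U \<in> \<U> \<Longrightarrow> y U \<in> topspace X - U"
      by metis
    have "finite (insert x (y ` ?F))" "insert x (y ` ?F) \<subseteq> topspace X"
      using fin x y by auto
    then obtain U where U: "U \<in> \<U>" "insert x (y ` ?F) \<subseteq> U"
      using \<U> unfolding omega_covers_def by blast
    \<comment> \<open>\<open>U\<close> contains \<open>x\<close>, so it is one of the members in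
      \<open>?F\<close> and its own missed point \<open>y U\<close> is in the finite set.\<close>
    then have "y U \<in> U" by blast
    with y [OF U(1)] show False by blast
  qed
  then show "\<U> \<in> large_covers X"
    using \<U> by (auto simp: omega_covers_def large_covers_def)
qed

lemma large_covers_subset_open_covers: "large_covers X \<subseteq> open_covers X"
  by (auto simp: large_covers_def)

lemma open_covers_subset_dense_families: "open_covers X \<subseteq> dense_families X"
  by (auto simp: open_covers_def dense_families_def)

section \<open>Implications between the principles\<close>

lemma S_one_antimono: "\<A> \<subseteq> \<A>' \<Longrightarrow> S_one \<A>' \<B> \<Longrightarrow> S_one \<A> \<B>"
  unfolding S_one_def by blast

lemma S_one_imp_S_fin:
  assumes "S_one \<A> \<B>"
  shows "S_fin \<A> \<B>"
  unfolding S_fin_def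
proof (intro allI impI)
  fix A :: "nat \<Rightarrow> 'a set"
  assume "\<forall>n. A n \<in> \<A>"
  then obtain b where b: "\<forall>n. b n \<in> A n" "range b \<in> \<B>"
    using assms unfolding S_one_def by blast
  have "(\<Union>n. {b n}) \<in> \<B>"
    using b(2) by (simp add: UNION_singleton_eq_range)
  with b(1) show "\<exists>B. (\<forall>n. finite (B n) \<and> B n \<subseteq> A n) \<and> (\<Union>n. B n) \<in> \<B>"
    by (intro exI [of _ "\<lambda>n. {b n}"]) auto
qed

lemma S_fin_imp_countable_dense_subfamilies:
  assumes "S_fin \<A> (dense_families X)"
  shows "countable_dense_subfamilies X \<A>"
  unfolding countable_dense_subfamilies_def
proof
  fix \<U> assume "\<U> \<in> \<A>"
  then have "\<exists>B. (\<forall>n::nat. finite (B n) \<and> B n \<subseteq> \<U>) \<and> (\<Union>n. B n) \<in> dense_families X"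
    \<comment> \<open>The principle is applied to the constant sequence \<open>\<U>\<close>; the
      union of the finite selections is then a countable subfamily of \<open>\<U>\<close>.\<close>
    using assms unfolding S_fin_def by (elim allE [of _ "\<lambda>_. \<U>"]) simp
  then obtain B where B: "\<forall>n::nat. finite (B n) \<and> B n \<subseteq> \<U>" "(\<Union>n. B n) \<in> dense_families X"
    by (elim exE conjE)
  show "\<exists>\<V> \<subseteq> \<U>. countable \<V> \<and> X closure_of \<Union>\<V> = topspace X"
  proof (intro exI conjI)
    show "(\<Union>n. B n) \<subseteq> \<U>" "countable (\<Union>n. B n)"
      using B(1) by (auto simp: countable_finite)
    show "X closure_of \<Union>(\<Union>n. B n) = topspace X"
      using B(2) by (simp add: dense_families_def)
  qed
qed

lemma countable_dense_subfamilies_antimono: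
  "\<A> \<subseteq> \<A>' \<Longrightarrow> countable_dense_subfamilies X \<A>' \<Longrightarrow> countable_dense_subfamilies X \<A>"
  unfolding countable_dense_subfamilies_def by blast

section \<open>The equivalences for manifolds\<close>

theorem theorem4p8:
  fixes M :: "'a topology"
  assumes "manifold M"
  shows
    "(separable_space M \<longleftrightarrow> S_one (k_covers M) (dense_families M)) \<and>
     (separable_space M \<longleftrightarrow> S_one (omega_covers M) (dense_families M)) \<and>
     (separable_space M \<longleftrightarrow> S_one (large_covers M) (dense_families M)) \<and>
     (separable_space M \<longleftrightarrow> S_one (open_covers M) (dense_families M)) \<and>
     (separable_space M \<longleftrightarrow> S_one (dense_families M) (dense_families M)) \<and>
     (separable_space M \<longleftrightarrow> S_fin (k_covers M) (dense_families M)) \<and>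
     (separable_space M \<longleftrightarrow> S_fin (omega_covers M) (dense_families M)) \<and>
     (separable_space M \<longleftrightarrow> S_fin (large_covers M) (dense_families M)) \<and>
     (separable_space M \<longleftrightarrow> S_fin (open_covers M) (dense_families M)) \<and>
     (separable_space M \<longleftrightarrow> S_fin (dense_families M) (dense_families M)) \<and>
     (separable_space M \<longleftrightarrow> countable_dense_subfamilies M (k_covers M)) \<and>
     (separable_space M \<longleftrightarrow> countable_dense_subfamilies M (omega_covers M)) \<and>
     (separable_space M \<longleftrightarrow> countable_dense_subfamilies M (large_covers M)) \<and>
     (separable_space M \<longleftrightarrow> countable_dense_subfamilies M (open_covers M)) \<and>
     (separable_space M \<longleftrightarrow> countable_dense_subfamilies M (dense_families M))"
proof -
  have ne: "topspace M \<noteq> {}"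
    using assms by (simp add: manifold_def)
  have loc: "\<exists>W. openin M W \<and> x \<in> W \<and> separable_space (subtopology M W)" if "x \<in> topspace M" for x
    using manifold_locally_second_countable [OF assms that] second_countable_imp_separable_space
    by metis
  \<comment> \<open>One cycle of implications handles every family \<open>\<A>\<close> between the
    two extremes: the upper bound passes \<open>S_one\<close> down from the dense families, and the
    lower bound restricts the countable subfamily property to k-covers.\<close>
  have equiv: "(separable_space M \<longleftrightarrow> S_one \<A> (dense_families M)) \<and>
      (separable_space M \<longleftrightarrow> S_fin \<A> (dense_families M)) \<and>
      (separable_space M \<longleftrightarrow> countable_dense_subfamilies M \<A>)"
    if "k_covers M \<subseteq> \<A>" "\<A> \<subseteq> dense_families M" for \<A>
  proof -
    have "separable_space M \<Longrightarrow> S_one \<A> (dense_families M)"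
      using S_one_dense_families [OF _ manifold_first_countable [OF assms] ne]
      by (rule S_one_antimono [OF that(2)])
    moreover have "S_one \<A> (dense_families M) \<Longrightarrow> S_fin \<A> (dense_families M)"
      by (rule S_one_imp_S_fin)
    moreover have "S_fin \<A> (dense_families M) \<Longrightarrow> countable_dense_subfamilies M \<A>"
      by (rule S_fin_imp_countable_dense_subfamilies)
    moreover have "countable_dense_subfamilies M \<A> \<Longrightarrow> separable_space M"
      using separable_space_if_k_covers [OF loc] countable_dense_subfamilies_antimono [OF that(1)]
      by blast
    ultimately show ?thesis by blast
  qed
  \<comment> \<open>The five families form a chain, so each of them lies between k-covers and dense
    families.\<close>
  note inclusions = k_covers_subset_omega_covers [of M] omega_covers_subset_large_covers [of M]
    large_covers_subset_open_covers [of M] open_covers_subset_dense_families [of M]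
  have between: "k_covers M \<subseteq> \<A> \<and> \<A> \<subseteq> dense_families M"
    if "\<A> \<in> {k_covers M, omega_covers M, large_covers M, open_covers M, dense_families M}" for \<A>
    using that inclusions by blast
  have equiv_members: "(separable_space M \<longleftrightarrow> S_one \<A> (dense_families M)) \<and>
      (separable_space M \<longleftrightarrow> S_fin \<A> (dense_families M)) \<and>
      (separable_space M \<longleftrightarrow> countable_dense_subfamilies M \<A>)"
    if "\<A> \<in> {k_covers M, omega_covers M, large_covers M, open_covers M, dense_families M}" for \<A>
    using between [OF that] by (intro equiv) simp_all
  show ?thesis
    by (intro conjI; rule equiv_members [THEN conjunct1]
        equiv_members [THEN conjunct2, THEN conjunct1]
        equiv_members [THEN conjunct2, THEN conjunct2]; simp)
qed

end
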